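(* For every integer $n\ge 0$ and every $j\in\{0,1,\ldots,7\}$, \[ \nu_2\bigl(t_9(8n+j)\bigr)=5\left\lceil\frac{\nu_2(n+1)}{2}\right\rceil-2\bigl(\nu_2(n+1)\bmod 2\bigr). \] In particular, $t_9(n)\neq 0$ for all $n\ge 0$.
   Context: Let $T(x)=\prod_{k=0}^{\infty}(1-x^{2^k})$, a formal power series with integer coefficients (the generating function of the Thue--Morse sequence $t(0)=1$, $t(2n)=t(n)$, $t(2n+1)=-t(n)$). For an integer $m\ge 1$ define the integers $t_m(n)$, $n\ge 0$, by $T(x)^m=\sum_{n\ge 0}t_m(n)x^n$. Here $\nu_2$ denotes the $2$-adic valuation on integers (with $\nu_2(0)=\infty$), and $a\bmod 2\in\{0,1\}$ denotes the remainder of $a$ upon division by $2$. *)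

theory Defs
  imports
    "HOL-Computational_Algebra.Computational_Algebra"
    "HOL-Analysis.Infinite_Products"
    "HOL-Library.Extended_Real"
begin

text \<open>The infinite product is the limit of the partial products in the usual (X-adic) topology
  on formal power series. It converges by \<open>thue_morse_has_prod\<close> below.\<close>

definition thue_morse_fps :: "int fps" where
  "thue_morse_fps = (\<Prod>k. 1 - fps_X ^ (2 ^ k))"

definition tm_coeff :: "nat \<Rightarrow> nat \<Rightarrow> int" where
  "tm_coeff m n = fps_nth (thue_morse_fps ^ m) n"

text \<open>The library's \<^const>\<open>multiplicity\<close> takes the value 0 at 0, whereas here the
  2-adic valuation of 0 is infinite.\<close>

definition val2 :: "int \<Rightarrow> ereal" where
  "val2 a = (if a = 0 then \<infinity> else ereal (real (multiplicity 2 a)))"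

lemma thue_morse_has_prod:
  "(\<lambda>k. 1 - fps_X ^ (2 ^ k) :: int fps) has_prod thue_morse_fps"
proof -
  let ?f = "\<lambda>k. 1 - fps_X ^ (2 ^ k) :: int fps"
  have nz: "?f k \<noteq> 0" for k
  proof -
    have "fps_nth (?f k) 0 = 1" by simp
    then show ?thesis by (metis fps_zero_nth zero_neq_one)
  qed
  have sub: "subdegree (?f k - 1) > n" if "k > n" for n k :: nat
  proof -
    have "subdegree (?f k - 1) = 2 ^ k" by simp
    moreover have "k < 2 ^ k" by (rule less_exp)
    ultimately show ?thesis using that by linarith
  qed
  obtain P where P: "(\<lambda>n. \<Prod>k\<le>n. ?f k) \<longlonglongrightarrow> P"
    using tendsto_prod_fps[of ?f "\<lambda>n. n", OF nz sub] by blast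
  have "fps_nth (\<Prod>k\<le>n. ?f k) 0 = 1" for n
    by (induction n) auto
  moreover have "\<forall>\<^sub>F n in sequentially. fps_nth (\<Prod>k\<le>n. ?f k) 0 = fps_nth P 0"
    using P by (simp only: tendsto_fps_iff)
  ultimately have "fps_nth P 0 = 1" by (auto simp: eventually_sequentially)
  then have "P \<noteq> 0" by auto
  with P have "raw_has_prod ?f 0 P" by (simp add: raw_has_prod_def)
  then have "?f has_prod P" by (simp add: has_prod_def)
  moreover have "thue_morse_fps = P"
    using P \<open>P \<noteq> 0\<close> unfolding thue_morse_fps_def
    by (metis calculation has_prod_unique)
  ultimately show ?thesis by simp
qed

end

theory Submission
  imports Defs "HOL-Number_Theory.Cong"
begin

text \<open>Write \<open>F = T ^ 9\<close>, so that \<open>F(x) = (1 - x) ^ 9 * F(x\<^sup>2)\<close>. Splitting into even and odd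
  exponents gives two linear operators on polynomials \<open>P\<close>, which describe the even and odd sections
  of \<open>P * F\<close>. On polynomials of degree at most 7 the odd operator has characteristic polynomial
  \<open>y ^ 8 - 6560 * y ^ 6 + 8472576 * y ^ 4 - 2235564032 * y ^ 2 + 2 ^ 36\<close>; after the substitution
  \<open>y ^ 2 = 32 * w\<close> and division by \<open>2 ^ 20\<close> it has integer coefficients and becomes
  \<open>w ^ 4 - w ^ 3\<close> modulo 2. So if \<open>n + 1 = 2 ^ v * (2 * m + 1)\<close>, the valuation of \<open>t9 (8 * n + j)\<close>
  increases by 5 whenever \<open>v\<close> increases by 2, once this is known for \<open>v < 8\<close>. There, modulo twice the
  claimed power of 2, the relevant polynomial is that power times \<open>1 + x ^ 8\<close>, and all coefficients
  of \<open>(1 + x ^ 8) * F\<close> are odd because \<open>F\<close> is congruent to \<open>1 / (1 - x) ^ 9\<close> modulo 2.\<close>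

section \<open>The functional equation of the product\<close>

lemma thue_morse_fps_nth_eventually:
  "\<forall>\<^sub>F N in sequentially.
     fps_nth (\<Prod>k\<le>N. 1 - fps_X ^ (2 ^ k)) n = fps_nth thue_morse_fps n"
  using has_prod_imp_tendsto [OF thue_morse_has_prod] by (simp only: tendsto_fps_iff)

lemma thue_morse_fps_nth_0: "fps_nth thue_morse_fps 0 = 1"
proof -
  have "fps_nth (\<Prod>k\<le>N. 1 - fps_X ^ (2 ^ k) :: int fps) 0 = 1" for N
    by (induction N) auto
  with thue_morse_fps_nth_eventually [of 0] show ?thesis
    by (auto simp: eventually_sequentially)
qed

lemma prod_fps_X_power_Suc:
  "(\<Prod>k\<le>Suc N. 1 - fps_X ^ (2 ^ k) :: int fps) =
     (1 - fps_X) * ((\<Prod>k\<le>N. 1 - fps_X ^ (2 ^ k)) oo fps_X ^ 2)"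
proof -
  have "(\<Prod>k\<le>N. 1 - fps_X ^ (2 ^ k) :: int fps) oo fps_X ^ 2 =
          (\<Prod>k\<le>N. (1 - fps_X ^ (2 ^ k)) oo fps_X ^ 2)"
    by (rule fps_compose_prod_distrib) simp
  also have "\<dots> = (\<Prod>k\<le>N. 1 - fps_X ^ (2 ^ Suc k))"
    by (intro prod.cong refl)
       (simp add: fps_compose_sub_distrib fps_compose_power [symmetric] power_mult [symmetric])
  finally show ?thesis
    by (simp only: prod.atMost_Suc_shift) simp
qed

lemma thue_morse_fps_functional_equation:
  "thue_morse_fps = (1 - fps_X) * (thue_morse_fps oo fps_X ^ 2)"
proof (rule fps_ext)
  fix n
  let ?P = "\<lambda>N. \<Prod>k\<le>N. 1 - fps_X ^ (2 ^ k) :: int fps"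
  \<comment> \<open>Coefficient \<open>n\<close> of \<open>(1 - x) * G(x^2)\<close> involves
    \<open>G\<close> only at \<open>n div 2\<close> or \<open>(n - 1) div 2\<close>, so agreement of
    one partial product with the limit at three places suffices.\<close>
  have "\<forall>\<^sub>F N in sequentially.
          fps_nth (?P (Suc N)) n = fps_nth thue_morse_fps n \<and>
          fps_nth (?P N) (n div 2) = fps_nth thue_morse_fps (n div 2) \<and>
          fps_nth (?P N) ((n - 1) div 2) = fps_nth thue_morse_fps ((n - 1) div 2)"
    by (intro eventually_conj thue_morse_fps_nth_eventually)
       (subst eventually_sequentially_Suc, rule thue_morse_fps_nth_eventually)
  then obtain N where N:
      "fps_nth (?P (Suc N)) n = fps_nth thue_morse_fps n"
      "fps_nth (?P N) (n div 2) = fps_nth thue_morse_fps (n div 2)"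
      "fps_nth (?P N) ((n - 1) div 2) = fps_nth thue_morse_fps ((n - 1) div 2)"
    by (auto simp: eventually_sequentially)
  have "fps_nth thue_morse_fps n = fps_nth ((1 - fps_X) * (?P N oo fps_X ^ 2)) n"
    using N(1) by (simp only: prod_fps_X_power_Suc)
  also have "\<dots> = fps_nth ((1 - fps_X) * (thue_morse_fps oo fps_X ^ 2)) n"
    using N(2,3) by (cases "n = 0") (simp_all add: left_diff_distrib fps_nth_compose_X_power)
  finally show "fps_nth thue_morse_fps n =
      fps_nth ((1 - fps_X) * (thue_morse_fps oo fps_X ^ 2)) n" .
qed

section \<open>Recurrences for the coefficients of the ninth power\<close>

text \<open>Extending by zero to negative indices makes the shifted recurrences below hold without
  boundary cases.\<close>

definition t9 :: "int \<Rightarrow> int" where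
  "t9 z = (if z < 0 then 0 else tm_coeff 9 (nat z))"

lemma one_minus_power9:
  fixes x :: "'a :: comm_ring_1"
  shows "(1 - x) ^ 9 = 1 - 9 * x + 36 * x^2 - 84 * x^3 + 126 * x^4 - 126 * x^5 + 84 * x^6
           - 36 * x^7 + 9 * x^8 - x^9"
  by (simp add: eval_nat_numeral algebra_simps)

text \<open>Here \<open>h\<close> is the coefficient sequence of \<open>T(x^2)^9\<close>, and its
  multipliers are the coefficients of \<open>(1 - x)^9\<close>.\<close>

lemma t9_mask:
  fixes z :: int
  defines "h \<equiv> \<lambda>y. if even y then t9 (y div 2) else 0"
  shows "t9 z = h z - 9 * h (z - 1) + 36 * h (z - 2) - 84 * h (z - 3) + 126 * h (z - 4)
           - 126 * h (z - 5) + 84 * h (z - 6) - 36 * h (z - 7) + 9 * h (z - 8) - h (z - 9)"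
proof (cases "z < 0")
  case True
  then have "h (z - i) = 0" if "i \<ge> 0" for i
    using that by (simp add: h_def t9_def pos_imp_zdiv_neg_iff)
  from this [of 0] this show ?thesis using True by (simp add: t9_def)
next
  case False
  define H where "H = thue_morse_fps ^ 9 oo fps_X ^ 2"
  have H_nth: "fps_nth H n = h (int n)" for n
    by (auto simp: H_def h_def t9_def tm_coeff_def fps_nth_compose_X_power nat_div_distrib)
  have h_neg: "h y = 0" if "y < 0" for y
    using that by (simp add: h_def t9_def)
  have shift: "fps_nth (fps_X ^ i * H) (nat z) = h (z - int i)" for i
    using False by (auto simp: fps_X_power_mult_nth H_nth h_neg of_nat_diff)
  have cshift: "fps_nth (numeral c * fps_X ^ i * H) (nat z) = numeral c * h (z - int i)" for c i
    unfolding mult.assoc by (simp only: fps_numeral_fps_const fps_mult_left_const_nth shift)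
  have "thue_morse_fps ^ 9 = (1 - fps_X) ^ 9 * H"
    unfolding H_def by (subst thue_morse_fps_functional_equation)
      (simp add: power_mult_distrib fps_compose_power)
  also have "\<dots> = fps_X ^ 0 * H - 9 * fps_X ^ 1 * H + 36 * fps_X ^ 2 * H - 84 * fps_X ^ 3 * H
      + 126 * fps_X ^ 4 * H - 126 * fps_X ^ 5 * H + 84 * fps_X ^ 6 * H - 36 * fps_X ^ 7 * H
      + 9 * fps_X ^ 8 * H - fps_X ^ 9 * H"
    by (simp add: one_minus_power9 algebra_simps)
  finally have "fps_nth (thue_morse_fps ^ 9) (nat z) = fps_nth (fps_X ^ 0 * H - 9 * fps_X ^ 1 * H
      + 36 * fps_X ^ 2 * H - 84 * fps_X ^ 3 * H
      + 126 * fps_X ^ 4 * H - 126 * fps_X ^ 5 * H + 84 * fps_X ^ 6 * H - 36 * fps_X ^ 7 * H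
      + 9 * fps_X ^ 8 * H - fps_X ^ 9 * H) (nat z)"
    by simp
  also have "\<dots> = h z - 9 * h (z - 1) + 36 * h (z - 2) - 84 * h (z - 3) + 126 * h (z - 4)
           - 126 * h (z - 5) + 84 * h (z - 6) - 36 * h (z - 7) + 9 * h (z - 8) - h (z - 9)"
    by (simp only: fps_add_nth fps_sub_nth shift cshift) simp
  finally show ?thesis
    using False by (simp add: t9_def tm_coeff_def)
qed

lemma t9_even:
  "t9 (2 * z) = t9 z + 36 * t9 (z - 1) + 126 * t9 (z - 2) + 84 * t9 (z - 3) + 9 * t9 (z - 4)"
proof -
  have "(2 * z - 2) div 2 = z - 1" "(2 * z - 4) div 2 = z - 2"
       "(2 * z - 6) div 2 = z - 3" "(2 * z - 8) div 2 = z - 4" by presburger+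
  then show ?thesis by (subst t9_mask) simp
qed

lemma t9_odd:
  "t9 (2 * z + 1) =
     - 9 * t9 z - 84 * t9 (z - 1) - 126 * t9 (z - 2) - 36 * t9 (z - 3) - t9 (z - 4)"
proof -
  have "(2 * z - 2) div 2 = z - 1" "(2 * z - 4) div 2 = z - 2"
       "(2 * z - 6) div 2 = z - 3" "(2 * z - 8) div 2 = z - 4" by presburger+
  then show ?thesis by (subst t9_mask) simp
qed

section \<open>Section operators on polynomials\<close>

text \<open>A list stands for the coefficients of a polynomial \<open>P\<close>; \<open>comb P z\<close> is the coefficient of
  \<open>x ^ z\<close> in \<open>P * T ^ 9\<close>, and \<open>sec0\<close>, \<open>sec1\<close> send \<open>P\<close> to the even and odd parts of
  \<open>(1 - x) ^ 9 * P\<close>.\<close>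

fun comb :: "int list \<Rightarrow> int \<Rightarrow> int" where
  "comb [] z = 0"
| "comb (c # cs) z = c * t9 z + comb cs (z - 1)"

fun add :: "int list \<Rightarrow> int list \<Rightarrow> int list" where
  "add [] bs = bs"
| "add as [] = as"
| "add (a # as) (b # bs) = (a + b) # add as bs"

definition scale :: "int \<Rightarrow> int list \<Rightarrow> int list" where
  "scale c = map ((*) c)"

fun sec0 :: "int list \<Rightarrow> int list" and sec1 :: "int list \<Rightarrow> int list" where
  "sec0 [] = []"
| "sec0 (c # cs) = add (scale c [1, 36, 126, 84, 9]) (0 # sec1 cs)"
| "sec1 [] = []"
| "sec1 (c # cs) = add (scale c [- 9, - 84, - 126, - 36, - 1]) (sec0 cs)"

lemma comb_add: "comb (add as bs) z = comb as z + comb bs z"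
  by (induction as bs arbitrary: z rule: add.induct) (simp_all add: algebra_simps)

lemma comb_scale: "comb (scale c as) z = c * comb as z"
  by (induction as arbitrary: z) (simp_all add: scale_def algebra_simps)

lemma comb_mod: "[comb (map (\<lambda>c. c mod d) cs) z = comb cs z] (mod d)"
proof (induction cs arbitrary: z)
  case (Cons c cs)
  show ?case
    unfolding list.map comb.simps by (intro cong_add cong_mult Cons.IH cong_refl cong_mod_leftI)
qed simp

lemma comb_sec:
  "comb cs (2 * z) = comb (sec0 cs) z"
  "comb cs (2 * z + 1) = comb (sec1 cs) z"
proof (induction cs arbitrary: z)
  case (Cons c cs)
  { case 1
    \<comment> \<open>The tail carries a factor \<open>x\<close>, which exchanges even and odd
      indices; hence both claims go through one induction.\<close>
    have "2 * z - 1 = 2 * (z - 1) + 1" by simp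
    then show ?case using Cons.IH(2) [of "z - 1"]
      by (simp add: comb_add comb_scale t9_even del: add.simps)
  next
    case 2
    show ?case using Cons.IH(1) [of z]
      by (simp add: comb_add comb_scale t9_odd del: add.simps) }
qed simp_all

text \<open>Adding 1 to the index turns the map from \<open>z\<close> to \<open>2 * z + 1\<close>
  into doubling, so each factor 2 costs one \<open>sec1\<close>.\<close>

lemma comb_sec1_power: "comb cs (2 ^ v * (n + 1) - 1) = comb ((sec1 ^^ v) cs) n"
proof (induction v arbitrary: cs)
  case (Suc v)
  have "comb cs (2 ^ Suc v * (n + 1) - 1) = comb cs (2 * (2 ^ v * (n + 1) - 1) + 1)"
    by (simp add: algebra_simps)
  also have "\<dots> = comb ((sec1 ^^ Suc v) cs) n"
    by (simp only: comb_sec Suc.IH funpow_Suc_right o_apply)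
  finally show ?case .
qed simp

abbreviation one_x8 :: "int list" where
  "one_x8 \<equiv> [1, 0, 0, 0, 0, 0, 0, 0, 1]"

text \<open>Modulo 2, \<open>(1 - x)^9 * (1 + x^8)\<close> is
  \<open>(1 + x)^17 = (1 + x) * (1 + x^16)\<close>, whose even and odd parts both give
  \<open>1 + x^8\<close>. Parity is thus inherited from \<open>n div 2\<close>, down to
  \<open>n = 0\<close>.\<close>

lemma odd_comb_one_x8:
  assumes "z \<ge> 0"
  shows "odd (comb one_x8 z)"
proof -
  have "odd (comb one_x8 (int n))" for n
  proof (induction n rule: less_induct)
    case (less n)
    show ?case
    proof (cases "n = 0")
      case True
      have "fps_nth thue_morse_fps 0 = 1"
        by (rule thue_morse_fps_nth_0)
      then show ?thesis
        using True by (simp add: t9_def tm_coeff_def fps_nth_power_0)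
    next
      case False
      have secs: "map (\<lambda>c. c mod 2) (sec0 one_x8) = one_x8"
            "map (\<lambda>c. c mod 2) (sec1 one_x8) = one_x8"
        by code_simp+
      have "odd (comb (sec0 one_x8) (int (n div 2)))" "odd (comb (sec1 one_x8) (int (n div 2)))"
        using less.IH [of "n div 2"] False comb_mod [of 2 "sec0 one_x8" "int (n div 2)"]
          comb_mod [of 2 "sec1 one_x8" "int (n div 2)"]
        unfolding secs by (simp_all only: cong_def even_iff_mod_2_eq_zero) simp_all
      moreover have "int n = 2 * int (n div 2) \<or> int n = 2 * int (n div 2) + 1"
        by presburger
      ultimately show ?thesis
        using comb_sec by metis
    qed
  qed
  from this [of "nat z"] show ?thesis using assms by simp
qed

section \<open>Residue classes modulo 8\<close>

text \<open>The binary digits of \<open>j\<close> are consumed lowest first, since each split by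
  parity strips the last digit of \<open>8 * n + j\<close>.\<close>

definition octsec :: "nat \<Rightarrow> int list" where
  "octsec j =
     (let s = (\<lambda>e. if even e then sec0 else sec1) in s (j div 2 div 2) (s (j div 2) (s j [1])))"

lemma comb_octsec:
  assumes "j < 8"
  shows "comb (octsec j) n = t9 (8 * n + int j)"
proof -
  have "j = 0 \<or> j = 1 \<or> j = 2 \<or> j = 3 \<or> j = 4 \<or> j = 5 \<or> j = 6 \<or> j = 7"
    using assms by linarith
  then show ?thesis
    by (elim disjE)
      (simp_all add: octsec_def comb_sec [symmetric] algebra_simps del: sec0.simps sec1.simps)
qed

text \<open>The recursion in steps of two suits the recurrence for \<open>sec1\<close>, which has
  only even powers; \<open>val9_eq\<close> gives the closed form.\<close>

fun val9 :: "nat \<Rightarrow> nat" where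
  "val9 0 = 0"
| "val9 (Suc 0) = 3"
| "val9 (Suc (Suc v)) = val9 v + 5"

text \<open>After \<open>v\<close> odd sections the index \<open>2 ^ v * (2 * m + 1) - 1\<close> has
  become \<open>2 * m\<close>, whence the final \<open>sec0\<close>. The modulus is one power of 2
  beyond the claimed valuation, so that the parity of the cofactor is visible.\<close>

lemma octsec_initial:
  assumes "j < 8" "v < 8"
  shows "map (\<lambda>c. c mod 2 ^ Suc (val9 v)) (sec0 ((sec1 ^^ v) (octsec j))) =
           scale (2 ^ val9 v) one_x8"
proof -
  have "list_all (\<lambda>j. list_all (\<lambda>v. map (\<lambda>c. c mod 2 ^ Suc (val9 v))
     (sec0 ((sec1 ^^ v) (octsec j))) = scale (2 ^ val9 v) one_x8) [0..<8]) [0..<8]"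
    by code_simp
  then show ?thesis using assms by (simp add: list_all_iff)
qed

text \<open>An instance of the Cayley-Hamilton theorem for \<open>sec1\<close>.\<close>

lemma octsec_recurrence:
  assumes "j < 8"
  shows "(sec1 ^^ 8) (octsec j) =
    add (scale 6560 ((sec1 ^^ 6) (octsec j))) (add (scale (- 8472576) ((sec1 ^^ 4) (octsec j)))
     (add (scale 2235564032 ((sec1 ^^ 2) (octsec j))) (scale (- 68719476736) (octsec j))))"
proof -
  have "list_all (\<lambda>j. (sec1 ^^ 8) (octsec j) =
    add (scale 6560 ((sec1 ^^ 6) (octsec j))) (add (scale (- 8472576) ((sec1 ^^ 4) (octsec j)))
     (add (scale 2235564032 ((sec1 ^^ 2) (octsec j))) (scale (- 68719476736) (octsec j))))) [0..<8]"
    by code_simp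
  then show ?thesis using assms by (simp add: list_all_iff)
qed

section \<open>Exact powers of 2 and the theorem\<close>

lemma t9_exact_power:
  assumes "j < 8" "m \<ge> 0"
  shows "\<exists>q. odd q \<and> t9 (8 * (2 ^ v * (2 * m + 1) - 1) + int j) = 2 ^ val9 v * q"
proof (induction v rule: less_induct)
  case (less v)
  define s where "s v = t9 (8 * (2 ^ v * (2 * m + 1) - 1) + int j)" for v
  have s: "s v = comb (octsec j) (2 ^ v * (2 * m + 1) - 1)" for v
    by (simp add: s_def comb_octsec assms)
  show ?case
  proof (cases "v < 8")
    case True
    let ?R = "sec0 ((sec1 ^^ v) (octsec j))"
    have "s v = comb ?R m"
      by (simp add: s comb_sec1_power comb_sec)
    moreover have "[comb (scale (2 ^ val9 v) one_x8) m = comb ?R m] (mod 2 ^ Suc (val9 v))"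
      using comb_mod [of "2 ^ Suc (val9 v)" ?R m] unfolding octsec_initial [OF assms(1) True] .
    ultimately have "[s v = 2 ^ val9 v * comb one_x8 m] (mod 2 ^ Suc (val9 v))"
      by (simp only: comb_scale cong_sym)
    then obtain k where "s v = 2 ^ val9 v * comb one_x8 m + 2 ^ Suc (val9 v) * k"
      by (metis cong_iff_lin cong_sym)
    then have "s v = 2 ^ val9 v * (comb one_x8 m + 2 * k)"
      by (simp add: algebra_simps)
    moreover have "odd (comb one_x8 m + 2 * k)"
      using odd_comb_one_x8 [OF assms(2)] by simp
    ultimately show ?thesis unfolding s_def by blast
  next
    case False
    then obtain u where v: "v = u + 8" by (metis add.commute le_Suc_ex not_less)
    let ?n = "2 ^ u * (2 * m + 1) - 1"
    have shift: "s (u + i) = comb ((sec1 ^^ i) (octsec j)) ?n" for i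
      by (subst comb_sec1_power [symmetric]) (simp add: s power_add algebra_simps)
    have rec: "s (u + 8) = 6560 * s (u + 6) - 8472576 * s (u + 4) + 2235564032 * s (u + 2)
        - 68719476736 * s u"
      by (simp only: shift octsec_recurrence [OF assms(1)]) (simp add: comb_add comb_scale s)
    obtain q0 where q0: "s u = 2 ^ val9 u * q0"
      using less.IH [of u] unfolding v s_def by auto
    obtain q2 where q2: "s (u + 2) = 2 ^ val9 (u + 2) * q2"
      using less.IH [of "u + 2"] unfolding v s_def by auto
    obtain q4 where q4: "s (u + 4) = 2 ^ val9 (u + 4) * q4"
      using less.IH [of "u + 4"] unfolding v s_def by auto
    obtain q6 where q6: "odd q6" "s (u + 6) = 2 ^ val9 (u + 6) * q6"
      using less.IH [of "u + 6"] unfolding v s_def by auto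
    have val9: "val9 (u + 2) = val9 u + 5" "val9 (u + 4) = val9 u + 10"
        "val9 (u + 6) = val9 u + 15" "val9 (u + 8) = val9 u + 20"
      by (simp_all add: eval_nat_numeral)
    \<comment> \<open>The recurrence coefficients are \<open>2^5 * 205\<close>,
      \<open>2^10 * 8274\<close>, \<open>2^15 * 68224\<close> and \<open>2^20 * 65536\<close>, so
      \<open>2 ^ (val9 u + 20)\<close> factors out. Only 205 is odd, so the parity is that of
      \<open>q6\<close>.\<close>
    have "s v = 2 ^ val9 v * (205 * q6 - 8274 * q4 + 68224 * q2 - 65536 * q0)"
      unfolding v rec q0 q2 q4 q6(2) val9 by (simp add: power_add algebra_simps)
    moreover have "odd (205 * q6 - 8274 * q4 + 68224 * q2 - 65536 * q0)"
      using q6(1) by simp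
    ultimately show ?thesis unfolding s_def by blast
  qed
qed

lemma val9_eq: "int (val9 v) = 5 * \<lceil>real v / 2\<rceil> - 2 * int (v mod 2)"
proof (induction v rule: val9.induct)
  case (3 v)
  have "\<lceil>real (Suc (Suc v)) / 2\<rceil> = \<lceil>real v / 2 + 1\<rceil>"
    by (rule arg_cong [of _ _ ceiling]) (simp add: field_simps)
  then show ?case using 3 by simp
qed (simp_all add: ceiling_eq_iff)

lemma val2_tm_coeff_9:
  assumes "j < 8"
  shows "val2 (tm_coeff 9 (8 * n + j)) = ereal (real (val9 (multiplicity 2 (n + 1))))"
proof -
  define v where "v = multiplicity 2 (n + 1)"
  obtain r where r: "n + 1 = 2 ^ v * r" "odd r"
    unfolding v_def by (rule multiplicity_decompose' [of "n + 1" 2]) auto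
  from r(2) obtain m where m: "r = 2 * m + 1" by (rule oddE)
  have "int n + 1 = int (2 ^ v * r)" using r(1) by linarith
  then have n: "2 ^ v * (2 * int m + 1) - 1 = int n" by (simp add: m algebra_simps)
  obtain q where q: "odd q" "t9 (8 * int n + int j) = 2 ^ val9 v * q"
    using t9_exact_power [OF assms, of "int m" v] unfolding n by auto
  have t: "tm_coeff 9 (8 * n + j) = 2 ^ val9 v * q"
    using q(2) by (simp add: t9_def nat_add_distrib nat_mult_distrib)
  have "multiplicity 2 (2 ^ val9 v * q) = val9 v"
    using q(1) by (intro multiplicity_eqI) auto
  moreover have "q \<noteq> 0" using q(1) by auto
  ultimately show ?thesis by (simp add: t val2_def v_def)
qed

theorem theorem3:
  shows "(\<forall>n::nat. \<forall>j\<in>{0..7::nat}.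
            val2 (tm_coeff 9 (8 * n + j)) =
              ereal (real_of_int
                (5 * \<lceil>real (multiplicity 2 (n + 1)) / 2\<rceil> - 2 * int (multiplicity 2 (n + 1) mod 2)))) \<and>
         (\<forall>n::nat. tm_coeff 9 n \<noteq> 0)"
proof (intro conjI allI ballI)
  fix n j :: nat
  assume "j \<in> {0..7}"
  then have "j < 8" by simp
  then show "val2 (tm_coeff 9 (8 * n + j)) =
              ereal (real_of_int
                (5 * \<lceil>real (multiplicity 2 (n + 1)) / 2\<rceil> - 2 * int (multiplicity 2 (n + 1) mod 2)))"
    by (simp only: val2_tm_coeff_9 val9_eq [symmetric] of_int_of_nat_eq)
next
  fix n :: nat
  \<comment> \<open>Every index has this form, and a finite valuation excludes 0.\<close>
  have "val2 (tm_coeff 9 (8 * (n div 8) + n mod 8)) \<noteq> \<infinity>"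
    by (subst val2_tm_coeff_9) simp_all
  then show "tm_coeff 9 n \<noteq> 0"
    by (auto simp: val2_def)
qed

end
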